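(* Let $p\in[1,+\infty]$, let $p'\in[1,+\infty]$ be defined by $\frac1p+\frac1{p'}=1$ (with $\frac{1}{\infty}=0$), and let $L_p=L_p(\Omega,\Sigma,\mu)$ be the real $L_p$-space over a measure space $(\Omega,\Sigma,\mu)$. Then $$\zeta_{L_p}\leqslant 2^{\left|\frac1p-\frac1{p'}\right|}.$$
   Context: For a real normed space $X$, $B_R(c)$ denotes the closed ball with center $c$ and radius $R>0$, $o$ is the origin, $\operatorname{co} D$ is the convex hull of $D$, and $\rho(x,A)=\inf_{a\in A}\|x-a\|$. The deviation of $A$ from $B$ is $h^{+}(A,B)=\sup_{x\in A}\rho(x,B)$. The CHD-constant (convex hull deviation constant) of $X$ is $\zeta_X=\sup h^{+}(\operatorname{co} D, D)$, where the supremum is over all nonempty sets $D\subset B_1(o)$. *)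

theory Defs
  imports "HOL-Analysis.Analysis" "HOL-Probability.Essential_Supremum"
begin

section \<open>Real normed spaces with explicit carrier\<close>

text \<open>
  The space \<open>L\<^sub>p(\<mu>)\<close> depends on a measure, which is a term, so it cannot be an instance of the
  type class of real normed vector spaces. Normed spaces are therefore records with an explicit carrier.
\<close>

record 'v normed_space =
  carrier :: "'v set"
  vzero :: 'v
  vadd :: "'v \<Rightarrow> 'v \<Rightarrow> 'v"
  vscale :: "real \<Rightarrow> 'v \<Rightarrow> 'v"
  vnorm :: "'v \<Rightarrow> real"

locale real_normed_space =
  fixes X :: "'v normed_space"
  assumes zero_closed: "vzero X \<in> carrier X"
    and add_closed: "\<lbrakk>x \<in> carrier X; y \<in> carrier X\<rbrakk> \<Longrightarrow> vadd X x y \<in> carrier X"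
    and scale_closed: "x \<in> carrier X \<Longrightarrow> vscale X a x \<in> carrier X"
    and add_assoc: "\<lbrakk>x \<in> carrier X; y \<in> carrier X; z \<in> carrier X\<rbrakk>
      \<Longrightarrow> vadd X (vadd X x y) z = vadd X x (vadd X y z)"
    and add_commute: "\<lbrakk>x \<in> carrier X; y \<in> carrier X\<rbrakk> \<Longrightarrow> vadd X x y = vadd X y x"
    and add_zero: "x \<in> carrier X \<Longrightarrow> vadd X x (vzero X) = x"
    and add_neg: "x \<in> carrier X \<Longrightarrow> vadd X x (vscale X (-1) x) = vzero X"
    and scale_add_right: "\<lbrakk>x \<in> carrier X; y \<in> carrier X\<rbrakk>
      \<Longrightarrow> vscale X a (vadd X x y) = vadd X (vscale X a x) (vscale X a y)"
    and scale_add_left: "x \<in> carrier X \<Longrightarrow> vscale X (a + b) x = vadd X (vscale X a x) (vscale X b x)"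
    and scale_scale: "x \<in> carrier X \<Longrightarrow> vscale X a (vscale X b x) = vscale X (a * b) x"
    and scale_one: "x \<in> carrier X \<Longrightarrow> vscale X 1 x = x"
    and norm_eq_zero: "x \<in> carrier X \<Longrightarrow> vnorm X x = 0 \<longleftrightarrow> x = vzero X"
    and norm_scale: "x \<in> carrier X \<Longrightarrow> vnorm X (vscale X a x) = \<bar>a\<bar> * vnorm X x"
    and norm_triangle: "\<lbrakk>x \<in> carrier X; y \<in> carrier X\<rbrakk>
      \<Longrightarrow> vnorm X (vadd X x y) \<le> vnorm X x + vnorm X y"

definition vdiff :: "'v normed_space \<Rightarrow> 'v \<Rightarrow> 'v \<Rightarrow> 'v" where
  "vdiff X x y = vadd X x (vscale X (-1) y)"

definition closed_ball :: "'v normed_space \<Rightarrow> 'v \<Rightarrow> real \<Rightarrow> 'v set" where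
  "closed_ball X c R = {x \<in> carrier X. vnorm X (vdiff X x c) \<le> R}"

definition convex_in :: "'v normed_space \<Rightarrow> 'v set \<Rightarrow> bool" where
  "convex_in X C \<longleftrightarrow> C \<subseteq> carrier X \<and>
    (\<forall>x\<in>C. \<forall>y\<in>C. \<forall>u\<ge>0. \<forall>v\<ge>0. u + v = 1 \<longrightarrow> vadd X (vscale X u x) (vscale X v y) \<in> C)"

definition conv_hull :: "'v normed_space \<Rightarrow> 'v set \<Rightarrow> 'v set" where
  "conv_hull X D = convex_in X hull D"


section \<open>The convex hull deviation constant\<close>

text \<open>Infima and suprema are taken in the extended reals, hence are never junk values.\<close>

definition dist_to_set :: "'v normed_space \<Rightarrow> 'v \<Rightarrow> 'v set \<Rightarrow> ereal" where
  "dist_to_set X x A = (INF a\<in>A. ereal (vnorm X (vdiff X x a)))"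

definition deviation :: "'v normed_space \<Rightarrow> 'v set \<Rightarrow> 'v set \<Rightarrow> ereal" where
  "deviation X A B = (SUP x\<in>A. dist_to_set X x B)"

definition chd_const :: "'v normed_space \<Rightarrow> ereal" where
  "chd_const X =
    (SUP D\<in>{D. D \<noteq> {} \<and> D \<subseteq> closed_ball X (vzero X) 1}. deviation X (conv_hull X D) D)"


section \<open>The real space \<open>L\<^sub>p\<close> over a measure space\<close>

definition Lp_fun :: "ereal \<Rightarrow> 'a measure \<Rightarrow> ('a \<Rightarrow> real) set" where
  "Lp_fun p M = {f \<in> borel_measurable M.
     if p = \<infinity> then esssup M (\<lambda>x. ereal \<bar>f x\<bar>) < \<infinity>
     else integrable M (\<lambda>x. \<bar>f x\<bar> powr real_of_ereal p)}"

text \<open>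
  If \<open>M\<close> is the zero measure, then the essential supremum is \<open>- \<infinity>\<close>, which \<open>real_of_ereal\<close> maps to 0,
  the norm of the only element of \<open>L\<^sub>\<infinity>\<close>.
\<close>

definition Lp_seminorm :: "ereal \<Rightarrow> 'a measure \<Rightarrow> ('a \<Rightarrow> real) \<Rightarrow> real" where
  "Lp_seminorm p M f =
    (if p = \<infinity> then real_of_ereal (esssup M (\<lambda>x. ereal \<bar>f x\<bar>))
     else (\<integral>x. \<bar>f x\<bar> powr real_of_ereal p \<partial>M) powr (1 / real_of_ereal p))"

definition Lp_rel :: "ereal \<Rightarrow> 'a measure \<Rightarrow> (('a \<Rightarrow> real) \<times> ('a \<Rightarrow> real)) set" where
  "Lp_rel p M = {(f, g). f \<in> Lp_fun p M \<and> g \<in> Lp_fun p M \<and> (AE x in M. f x = g x)}"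

definition Lp :: "ereal \<Rightarrow> 'a measure \<Rightarrow> ('a \<Rightarrow> real) set normed_space" where
  "Lp p M = \<lparr>
     carrier = Lp_fun p M // Lp_rel p M,
     vzero = Lp_rel p M `` {\<lambda>x. 0},
     vadd = (\<lambda>F G. \<Union>f\<in>F. \<Union>g\<in>G. Lp_rel p M `` {\<lambda>x. f x + g x}),
     vscale = (\<lambda>a F. \<Union>f\<in>F. Lp_rel p M `` {\<lambda>x. a * f x}),
     vnorm = (\<lambda>F. the_elem (Lp_seminorm p M ` F)) \<rparr>"


section \<open>\<open>L\<^sub>p\<close> is a real normed space\<close>

lemma convex_powr_nonneg:
  fixes s t u v r :: real
  assumes r: "1 \<le> r" and st: "0 \<le> s" "0 \<le> t" and uv: "0 \<le> u" "0 \<le> v" "u + v = 1"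
  shows "(u * s + v * t) powr r \<le> u * s powr r + v * t powr r"
proof -
  have *: "(w * x) powr r \<le> w * x powr r" if "0 \<le> w" "w \<le> 1" "0 \<le> x" for w x :: real
  proof -
    have "w powr r \<le> w"
      using that r powr_mono'[of 1 r w] by (cases "w = 0") auto
    then show ?thesis
      using that by (simp add: powr_mult mult_right_mono)
  qed
  consider "s = 0" | "t = 0" | "0 < s" "0 < t"
    using st by linarith
  then show ?thesis
  proof cases
    case 1
    then show ?thesis using *[of v t] uv st by simp
  next
    case 2
    then show ?thesis using *[of u s] uv st by simp
  next
    case 3
    have u: "u = 1 - v"
      using uv by simp
    have "((1 - v) * s + v * t) powr r \<le> (1 - v) * s powr r + v * t powr r"
      using convex_onD[OF powr_convex[OF r], of v s t] uv 3 by simp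
    then show ?thesis
      by (simp add: u)
  qed
qed

lemma add_powr_le:
  fixes f g a b r :: real
  assumes r: "1 \<le> r" and ab: "0 < a" "0 < b"
  shows "\<bar>f + g\<bar> powr r \<le>
    (a + b) powr r * (a / (a + b) * (\<bar>f\<bar> powr r / a powr r) + b / (a + b) * (\<bar>g\<bar> powr r / b powr r))"
proof -
  have "\<bar>f + g\<bar> powr r \<le> (\<bar>f\<bar> + \<bar>g\<bar>) powr r"
    using r by (intro powr_mono2) auto
  also have "\<bar>f\<bar> + \<bar>g\<bar> = (a + b) * (a / (a + b) * (\<bar>f\<bar> / a) + b / (a + b) * (\<bar>g\<bar> / b))"
    using ab by (simp add: divide_simps)
  also have "\<dots> powr r =
      (a + b) powr r * (a / (a + b) * (\<bar>f\<bar> / a) + b / (a + b) * (\<bar>g\<bar> / b)) powr r"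
    using ab by (intro powr_mult)
  also have "\<dots> \<le> (a + b) powr r * (a / (a + b) * (\<bar>f\<bar> / a) powr r + b / (a + b) * (\<bar>g\<bar> / b) powr r)"
    using ab by (intro mult_left_mono convex_powr_nonneg[OF r]) (auto simp: add_divide_distrib[symmetric])
  finally show ?thesis
    using ab by (simp add: powr_divide)
qed

lemma Lp_fun_measurable: "f \<in> Lp_fun p M \<Longrightarrow> f \<in> borel_measurable M"
  by (simp add: Lp_fun_def)

lemma exponent_cases:
  fixes p :: ereal
  assumes "1 \<le> p"
  obtains "p = \<infinity>" | r where "p = ereal r" "1 \<le> r"
  using assms by (cases p) auto

lemma Lp_fun_infinity_bound:
  assumes "f \<in> Lp_fun \<infinity> M"
  shows "AE x in M. \<bar>f x\<bar> \<le> Lp_seminorm \<infinity> M f"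
proof -
  let ?e = "esssup M (\<lambda>x. ereal \<bar>f x\<bar>)"
  have "AE x in M. ereal \<bar>f x\<bar> \<le> ?e"
    by (rule esssup_AE)
  then show ?thesis
  proof eventually_elim
    case (elim x)
    then show ?case using assms by (cases ?e) (auto simp: Lp_seminorm_def Lp_fun_def)
  qed
qed

lemma Lp_infinity_boundI:
  assumes f: "f \<in> borel_measurable M" and c: "AE x in M. \<bar>f x\<bar> \<le> c"
  shows "f \<in> Lp_fun \<infinity> M" and "0 \<le> c \<Longrightarrow> Lp_seminorm \<infinity> M f \<le> c"
proof -
  have *: "esssup M (\<lambda>x. ereal \<bar>f x\<bar>) \<le> ereal c"
    using f c by (intro esssup_I) auto
  then show "f \<in> Lp_fun \<infinity> M"
    using f by (auto simp: Lp_fun_def)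
  show "0 \<le> c \<Longrightarrow> Lp_seminorm \<infinity> M f \<le> c"
    using * by (cases "esssup M (\<lambda>x. ereal \<bar>f x\<bar>)") (auto simp: Lp_seminorm_def)
qed

lemma Lp_seminorm_nonneg: "0 \<le> Lp_seminorm p M f"
proof (cases "p = \<infinity>")
  case True
  show ?thesis
  proof (cases "(\<lambda>x. ereal \<bar>f x\<bar>) \<in> borel_measurable M \<and> emeasure M (space M) \<noteq> 0")
    case True
    then have "esssup M (\<lambda>x. 0) \<le> esssup M (\<lambda>x. ereal \<bar>f x\<bar>)"
      by (intro esssup_mono) auto
    with True show ?thesis
      using \<open>p = \<infinity>\<close> by (simp add: Lp_seminorm_def esssup_const real_of_ereal_pos)
  next
    case False
    then have "esssup M (\<lambda>x. ereal \<bar>f x\<bar>) \<in> {\<infinity>, - \<infinity>}"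
      using esssup_non_measurable[of "\<lambda>x. ereal \<bar>f x\<bar>" M] esssup_zero_space[of M "\<lambda>x. ereal \<bar>f x\<bar>"]
      by (auto simp: top_ereal_def)
    then show ?thesis
      using \<open>p = \<infinity>\<close> by (auto simp: Lp_seminorm_def)
  qed
qed (simp add: Lp_seminorm_def)

lemma Lp_fun_zero: "(\<lambda>x. 0) \<in> Lp_fun p M"
  using Lp_infinity_boundI(1)[of "\<lambda>x. 0" M 0] by (cases "p = \<infinity>") (auto simp: Lp_fun_def)

lemma Lp_fun_add:
  assumes p: "1 \<le> p" and f: "f \<in> Lp_fun p M" and g: "g \<in> Lp_fun p M"
  shows "(\<lambda>x. f x + g x) \<in> Lp_fun p M"
    and "Lp_seminorm p M (\<lambda>x. f x + g x) \<le> Lp_seminorm p M f + Lp_seminorm p M g"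
proof -
  note [measurable] = Lp_fun_measurable[OF f] Lp_fun_measurable[OF g]
  have "(\<lambda>x. f x + g x) \<in> Lp_fun p M \<and>
    Lp_seminorm p M (\<lambda>x. f x + g x) \<le> Lp_seminorm p M f + Lp_seminorm p M g"
    using p
  proof (cases p rule: exponent_cases)
    case 1
    have "AE x in M. \<bar>f x + g x\<bar> \<le> Lp_seminorm p M f + Lp_seminorm p M g"
      using Lp_fun_infinity_bound[of f M] Lp_fun_infinity_bound[of g M] f g unfolding 1
      by (auto elim!: eventually_elim2)
    then show ?thesis
      using Lp_infinity_boundI[of "\<lambda>x. f x + g x" M] Lp_seminorm_nonneg[of p M f]
        Lp_seminorm_nonneg[of p M g] unfolding 1 by auto
  next
    case (2 r)
    define a where "a e = Lp_seminorm p M f + e" for e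
    define b where "b e = Lp_seminorm p M g + e" for e
    define B where "B e x = (a e + b e) powr r * (a e / (a e + b e) * (\<bar>f x\<bar> powr r / a e powr r) +
      b e / (a e + b e) * (\<bar>g x\<bar> powr r / b e powr r))" for e x
    have If: "integrable M (\<lambda>x. \<bar>f x\<bar> powr r)" and Ig: "integrable M (\<lambda>x. \<bar>g x\<bar> powr r)"
      using f g 2 by (auto simp: Lp_fun_def)
    have ab: "a e > 0" "b e > 0" if "e > 0" for e
      using that Lp_seminorm_nonneg[of p M f] Lp_seminorm_nonneg[of p M g] by (auto simp: a_def b_def)
    have IB: "integrable M (B e)" for e
      unfolding B_def using If Ig by auto
    have le: "\<bar>f x + g x\<bar> powr r \<le> B e x" if "e > 0" for e x
      unfolding B_def using add_powr_le[OF \<open>1 \<le> r\<close>] ab[OF that] by blast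
    have I: "integrable M (\<lambda>x. \<bar>f x + g x\<bar> powr r)"
    proof (rule Bochner_Integration.integrable_bound[OF IB[of 1]])
      show "AE x in M. norm (\<bar>f x + g x\<bar> powr r) \<le> norm (B 1 x)"
        using le[of 1] by (auto intro!: AE_I2 order_trans[OF le abs_ge_self])
    qed simp
    have int_eq: "(\<integral>x. \<bar>h x\<bar> powr r \<partial>M) = Lp_seminorm p M h powr r" for h
      using 2 by (simp add: Lp_seminorm_def powr_powr)
    have "Lp_seminorm p M (\<lambda>x. f x + g x) \<le> Lp_seminorm p M f + Lp_seminorm p M g + e"
      if e: "e > 0" for e
    proof -
      have le1: "Lp_seminorm p M f powr r \<le> a (e/2) powr r" "Lp_seminorm p M g powr r \<le> b (e/2) powr r"
        using e 2 Lp_seminorm_nonneg by (auto intro!: powr_mono2 simp: a_def b_def)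
      have pos: "a (e/2) > 0" "b (e/2) > 0"
        using ab[of "e/2"] e by auto
      have "(\<integral>x. \<bar>f x + g x\<bar> powr r \<partial>M) \<le> (\<integral>x. B (e/2) x \<partial>M)"
        using I IB le[of "e/2"] e by (intro integral_mono) auto
      also have "\<dots> = (a (e/2) + b (e/2)) powr r *
          (a (e/2) / (a (e/2) + b (e/2)) * (Lp_seminorm p M f powr r / a (e/2) powr r) +
          b (e/2) / (a (e/2) + b (e/2)) * (Lp_seminorm p M g powr r / b (e/2) powr r))"
        unfolding B_def using If Ig by (simp add: int_eq)
      also have "\<dots> \<le> (a (e/2) + b (e/2)) powr r *
          (a (e/2) / (a (e/2) + b (e/2)) * 1 + b (e/2) / (a (e/2) + b (e/2)) * 1)"
        using le1 pos by (intro mult_left_mono add_mono) (auto simp: divide_le_eq_1)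
      also have "\<dots> = (a (e/2) + b (e/2)) powr r"
        using pos by (simp add: add_divide_distrib[symmetric])
      finally have "(\<integral>x. \<bar>f x + g x\<bar> powr r \<partial>M) powr (1 / r) \<le> ((a (e/2) + b (e/2)) powr r) powr (1 / r)"
        using 2 by (intro powr_mono2) auto
      also have "\<dots> = a (e/2) + b (e/2)"
        using pos 2 by (simp add: powr_powr)
      finally show ?thesis
        using 2 by (simp add: Lp_seminorm_def a_def b_def)
    qed
    then have "Lp_seminorm p M (\<lambda>x. f x + g x) \<le> Lp_seminorm p M f + Lp_seminorm p M g"
      by (rule field_le_epsilon)
    then show ?thesis
      using I 2 by (auto simp: Lp_fun_def)
  qed
  then show "(\<lambda>x. f x + g x) \<in> Lp_fun p M"
    and "Lp_seminorm p M (\<lambda>x. f x + g x) \<le> Lp_seminorm p M f + Lp_seminorm p M g"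
    by auto
qed

lemma Lp_fun_scale:
  assumes p: "1 \<le> p" and f: "f \<in> Lp_fun p M"
  shows "(\<lambda>x. a * f x) \<in> Lp_fun p M"
    and "Lp_seminorm p M (\<lambda>x. a * f x) = \<bar>a\<bar> * Lp_seminorm p M f"
proof -
  note [measurable] = Lp_fun_measurable[OF f]
  have "(\<lambda>x. a * f x) \<in> Lp_fun p M \<and> Lp_seminorm p M (\<lambda>x. a * f x) = \<bar>a\<bar> * Lp_seminorm p M f"
    using p
  proof (cases p rule: exponent_cases)
    case 1
    have le: "(\<lambda>x. c * h x) \<in> Lp_fun p M \<and> Lp_seminorm p M (\<lambda>x. c * h x) \<le> \<bar>c\<bar> * Lp_seminorm p M h"
      if h: "h \<in> Lp_fun p M" for c h
    proof -
      have "AE x in M. \<bar>c * h x\<bar> \<le> \<bar>c\<bar> * Lp_seminorm p M h"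
        using Lp_fun_infinity_bound[of h M] h unfolding 1
        by (auto simp: abs_mult elim!: eventually_mono intro!: mult_left_mono)
      then show ?thesis
        using Lp_infinity_boundI[of "\<lambda>x. c * h x" M] Lp_seminorm_nonneg[of p M h]
          Lp_fun_measurable[OF h] unfolding 1 by auto
    qed
    show ?thesis
    proof (cases "a = 0")
      case True
      then show ?thesis using le[OF f, of a] Lp_seminorm_nonneg[of p M "\<lambda>x. a * f x"] by auto
    next
      case False
      then have "Lp_seminorm p M f \<le> \<bar>1 / a\<bar> * Lp_seminorm p M (\<lambda>x. a * f x)"
        using le[of "\<lambda>x. a * f x" "1 / a"] le[OF f, of a] by simp
      then have "\<bar>a\<bar> * Lp_seminorm p M f \<le> Lp_seminorm p M (\<lambda>x. a * f x)"
        using False by (simp add: field_simps)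
      then show ?thesis
        using le[OF f, of a] by auto
    qed
  next
    case (2 r)
    then show ?thesis
      using f by (auto simp: Lp_fun_def Lp_seminorm_def abs_mult powr_mult powr_powr)
  qed
  then show "(\<lambda>x. a * f x) \<in> Lp_fun p M"
    and "Lp_seminorm p M (\<lambda>x. a * f x) = \<bar>a\<bar> * Lp_seminorm p M f"
    by auto
qed

lemma Lp_seminorm_cong:
  assumes f: "f \<in> Lp_fun p M" and g: "g \<in> Lp_fun p M" and eq: "AE x in M. f x = g x"
  shows "Lp_seminorm p M f = Lp_seminorm p M g"
proof -
  note [measurable] = Lp_fun_measurable[OF f] Lp_fun_measurable[OF g]
  have "esssup M (\<lambda>x. ereal \<bar>f x\<bar>) = esssup M (\<lambda>x. ereal \<bar>g x\<bar>)"
    using eq by (intro esssup_AE_cong) (auto elim: eventually_mono)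
  moreover have "(\<integral>x. \<bar>f x\<bar> powr q \<partial>M) = (\<integral>x. \<bar>g x\<bar> powr q \<partial>M)" for q
    using eq by (intro integral_cong_AE) (auto elim: eventually_mono)
  ultimately show ?thesis
    by (simp add: Lp_seminorm_def)
qed

lemma Lp_seminorm_eq_0:
  assumes p: "1 \<le> p" and f: "f \<in> Lp_fun p M" and 0: "Lp_seminorm p M f = 0"
  shows "AE x in M. f x = 0"
  using p
proof (cases p rule: exponent_cases)
  case 1
  then show ?thesis
    using Lp_fun_infinity_bound[of f M] f 0 by (auto elim: eventually_mono)
next
  case (2 r)
  then have "(\<integral>x. \<bar>f x\<bar> powr r \<partial>M) = 0" "integrable M (\<lambda>x. \<bar>f x\<bar> powr r)"
    using f 0 by (auto simp: Lp_seminorm_def Lp_fun_def)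
  then have "AE x in M. \<bar>f x\<bar> powr r = 0"
    using integral_nonneg_eq_0_iff_AE[of M "\<lambda>x. \<bar>f x\<bar> powr r"] by simp
  then show ?thesis
    by (auto elim: eventually_mono)
qed

lemma equiv_Lp_rel: "equiv (Lp_fun p M) (Lp_rel p M)"
  by (auto intro!: equivI refl_onI symI transI simp: Lp_rel_def elim: eventually_mono eventually_elim2)

definition Lp_class :: "ereal \<Rightarrow> 'a measure \<Rightarrow> ('a \<Rightarrow> real) \<Rightarrow> ('a \<Rightarrow> real) set" where
  "Lp_class p M f = Lp_rel p M `` {f}"

lemma Lp_class_eq_iff:
  "\<lbrakk>f \<in> Lp_fun p M; g \<in> Lp_fun p M\<rbrakk> \<Longrightarrow> Lp_class p M f = Lp_class p M g \<longleftrightarrow> (AE x in M. f x = g x)"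
  using eq_equiv_class_iff[OF equiv_Lp_rel, of f p M g] by (auto simp: Lp_class_def Lp_rel_def)

lemma carrier_Lp: "carrier (Lp p M) = Lp_class p M ` Lp_fun p M"
  by (auto simp: Lp_def Lp_class_def quotient_def)

lemma vzero_Lp: "vzero (Lp p M) = Lp_class p M (\<lambda>x. 0)"
  by (simp add: Lp_def Lp_class_def)

lemma vadd_Lp:
  assumes p: "1 \<le> p" and f: "f \<in> Lp_fun p M" and g: "g \<in> Lp_fun p M"
  shows "vadd (Lp p M) (Lp_class p M f) (Lp_class p M g) = Lp_class p M (\<lambda>x. f x + g x)"
proof -
  have "(\<lambda>f g. Lp_rel p M `` {\<lambda>x. f x + g x}) respects2 Lp_rel p M"
  proof (rule congruent2I')
    fix f f' g g' assume rel: "(f, f') \<in> Lp_rel p M" "(g, g') \<in> Lp_rel p M"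
    then have "AE x in M. f x + g x = f' x + g' x"
      by (auto simp: Lp_rel_def elim: eventually_elim2)
    with rel show "Lp_rel p M `` {\<lambda>x. f x + g x} = Lp_rel p M `` {\<lambda>x. f' x + g' x}"
      using p by (intro equiv_class_eq[OF equiv_Lp_rel]) (simp add: Lp_rel_def Lp_fun_add(1))
  qed
  from UN_equiv_class2[OF equiv_Lp_rel equiv_Lp_rel this f g] show ?thesis
    by (simp add: Lp_def Lp_class_def)
qed

lemma vscale_Lp:
  assumes p: "1 \<le> p" and f: "f \<in> Lp_fun p M"
  shows "vscale (Lp p M) a (Lp_class p M f) = Lp_class p M (\<lambda>x. a * f x)"
proof -
  have "(\<lambda>f. Lp_rel p M `` {\<lambda>x. a * f x}) respects Lp_rel p M"
  proof (rule congruentI)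
    fix f f' assume "(f, f') \<in> Lp_rel p M"
    then show "Lp_rel p M `` {\<lambda>x. a * f x} = Lp_rel p M `` {\<lambda>x. a * f' x}"
      using p by (intro equiv_class_eq[OF equiv_Lp_rel])
        (auto simp: Lp_rel_def intro!: Lp_fun_scale(1) elim: eventually_mono)
  qed
  from UN_equiv_class[OF equiv_Lp_rel this f] show ?thesis
    by (simp add: Lp_def Lp_class_def)
qed

lemma vnorm_Lp:
  assumes f: "f \<in> Lp_fun p M"
  shows "vnorm (Lp p M) (Lp_class p M f) = Lp_seminorm p M f"
proof -
  have "f \<in> Lp_class p M f"
    using f by (simp add: Lp_class_def Lp_rel_def)
  moreover have "Lp_seminorm p M g = Lp_seminorm p M f" if "g \<in> Lp_class p M f" for g
    using that by (auto simp: Lp_class_def Lp_rel_def intro!: Lp_seminorm_cong elim: eventually_mono)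
  ultimately have "the_elem (Lp_seminorm p M ` Lp_class p M f) = Lp_seminorm p M f"
    by (intro the_elem_image_unique) blast+
  then show ?thesis
    by (simp add: Lp_def)
qed

theorem real_normed_space_Lp:
  assumes p: "1 \<le> p"
  shows "real_normed_space (Lp p M)"
proof -
  note simps = vzero_Lp vadd_Lp[OF p] vscale_Lp[OF p] vnorm_Lp
    Lp_fun_zero Lp_fun_add[OF p] Lp_fun_scale[OF p]
  have norm: "Lp_seminorm p M f = 0 \<longleftrightarrow> Lp_class p M f = Lp_class p M (\<lambda>x. 0)"
    if "f \<in> Lp_fun p M" for f
    using that Lp_seminorm_eq_0[OF p that] Lp_seminorm_cong[OF that Lp_fun_zero]
      Lp_fun_scale(2)[OF p that, of 0] Lp_fun_scale(2)[OF p Lp_fun_zero, of M 0]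
    by (auto simp: Lp_class_eq_iff Lp_fun_zero)
  show ?thesis
  proof
    fix x assume "x \<in> carrier (Lp p M)"
    then obtain f where f: "f \<in> Lp_fun p M" "x = Lp_class p M f"
      by (auto simp: carrier_Lp)
    then show "vadd (Lp p M) x (vscale (Lp p M) (-1) x) = vzero (Lp p M)"
      using vadd_Lp[OF p f(1) Lp_fun_scale(1)[OF p f(1), of "-1"]] by (simp add: simps)
  qed (auto simp: carrier_Lp simps norm algebra_simps)
qed

end

theory Submission
  imports Defs
begin

text \<open>
  Let \<open>g = \<Sum>w\<^sub>i f\<^sub>i\<close> be a convex combination of functions in the unit ball of \<open>L\<^sub>r\<close>, with \<open>r\<close> finite.
  Some \<open>f\<^sub>i\<close> is close to \<open>g\<close> because they are close on average:
  \<open>\<Sum>w\<^sub>i \<parallel>g - f\<^sub>i\<parallel>\<^sup>r \<le> 2 powr \<bar>r - 2\<bar> * \<Sum>w\<^sub>i \<parallel>f\<^sub>i\<parallel>\<^sup>r \<le> 2 powr \<bar>r - 2\<bar>\<close>, and the \<open>r\<close>-th root of the right-hand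
  side is the asserted bound, since \<open>1/r - 1/r' = (2 - r)/r\<close>. One could obtain the first inequality
  by interpolating the operator \<open>X \<mapsto> X - E X\<close> between \<open>L\<^sub>2\<close>, where its norm is at most 1, and
  \<open>L\<^sub>1\<close> or \<open>L\<^sub>\<infinity>\<close>, where its norm is at most 2. But as the \<open>r\<close>-th power of the norm is an integral,
  it is enough to have the inequality for real numbers at each point:
  \<open>E\<bar>X - m\<bar>\<^sup>r \<le> 2 powr \<bar>r - 2\<bar> * E\<bar>X\<bar>\<^sup>r\<close> for a finitely valued random variable \<open>X\<close> with mean \<open>m\<close>
  (\<open>sum_powr_deviation_from_mean_le\<close>).

  This scalar inequality has an elementary proof. A multiple of \<open>m - X\<close> has mean 0 and can be added
  freely, so it suffices that for some \<open>K\<close> depending on \<open>m\<close>,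
  \<open>\<bar>x - m\<bar>\<^sup>r \<le> 2 powr \<bar>r - 2\<bar> * \<bar>x\<bar>\<^sup>r + K (m - x)\<close> for all real \<open>x\<close> (\<open>powr_shift\<close>). By homogeneity \<open>m = 1\<close>, and
  there differentiation in \<open>x\<close> reduces the claim to inequalities between \<open>s\<^sup>r\<^sup>-\<^sup>1\<close>, 1 and
  \<open>(1 + s)\<^sup>r\<^sup>-\<^sup>1\<close> that express convexity or concavity of the power and its super- or subadditivity
  (\<open>powr_slopes\<close>).

  For \<open>p = \<infinity>\<close> the bound is 2, and two points of the unit ball are never farther apart.
\<close>

section \<open>A scalar inequality for deviations from the mean\<close>

text \<open>
  The two inequalities are what remains of \<open>powr_shift_one\<close> after differentiation; \<open>p \<kappa>\<close> becomes the
  constant \<open>K\<close> there. Both exponent ranges use the midpoint inequality for \<open>x powr (p - 1)\<close>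
  and its superadditivity or subadditivity, with roles exchanged at \<open>p = 2\<close>: for \<open>p \<ge> 2\<close> the factor
  \<open>2 powr (p - 2)\<close> comes from convexity in the second inequality, and \<open>\<kappa> = 2 powr (p - 2)\<close>; for \<open>p \<le> 2\<close> the
  factor \<open>2 powr (2 - p)\<close> comes from concavity in the first, and \<open>\<kappa> = 1\<close>.
\<close>

lemma powr_slopes:
  fixes p :: real
  assumes p: "1 \<le> p"
  obtains \<kappa> where "1 \<le> \<kappa>"
    and "\<And>s. 0 < s \<Longrightarrow> s powr (p - 1) + \<kappa> \<le> 2 powr \<bar>p - 2\<bar> * (1 + s) powr (p - 1)"
    and "\<And>s. 0 < s \<Longrightarrow> (1 + s) powr (p - 1) \<le> 2 powr \<bar>p - 2\<bar> * s powr (p - 1) + \<kappa>"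
proof (cases "2 \<le> p")
  case True
  define c :: real where "c = 2 powr (p - 2)"
  have c: "1 \<le> c"
    using True by (simp add: c_def ge_one_powr_ge_zero)
  show ?thesis
  proof (rule that[of c])
    fix s :: real assume s: "0 < s"
    have *: "x powr (p - 1) = x * x powr (p - 2)" if "0 < x" for x :: real
      using that powr_add[of x 1 "p - 2"] by simp
    have "s powr (p - 2) \<le> (1 + s) powr (p - 2)" "1 \<le> (1 + s) powr (p - 2)"
      using s True by (auto intro: powr_mono2 ge_one_powr_ge_zero)
    then have "s * s powr (p - 2) + 1 \<le> s * (1 + s) powr (p - 2) + (1 + s) powr (p - 2)"
      using s by (intro add_mono mult_left_mono) auto
    then have "s powr (p - 1) + 1 \<le> (1 + s) powr (p - 1)"
      using s by (simp add: * distrib_right)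
    then have "c * (s powr (p - 1) + 1) \<le> c * (1 + s) powr (p - 1)"
      using c by (intro mult_left_mono) auto
    moreover have "s powr (p - 1) \<le> c * s powr (p - 1)"
      using c mult_right_mono[of 1 c "s powr (p - 1)"] by simp
    ultimately show "s powr (p - 1) + c \<le> 2 powr \<bar>p - 2\<bar> * (1 + s) powr (p - 1)"
      using True by (simp add: c_def distrib_left)
    \<comment> \<open>midpoint convexity at \<open>s\<close> and 1\<close>
    have "((1 + s) / 2) powr (p - 1) \<le> (s powr (p - 1) + 1) / 2"
      using convex_powr_nonneg[of "p - 1" s 1 "1/2" "1/2"] s True by (simp add: add_divide_distrib add.commute)
    then have "(1 + s) powr (p - 1) \<le> 2 powr (p - 1) / 2 * (s powr (p - 1) + 1)"
      using s by (simp add: powr_divide field_simps)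
    also have "2 powr (p - 1) / 2 = c"
      by (simp add: * c_def)
    finally show "(1 + s) powr (p - 1) \<le> 2 powr \<bar>p - 2\<bar> * s powr (p - 1) + c"
      using True by (simp add: c_def distrib_left)
  qed (use c in auto)
next
  case False
  define q where "q = p - 1"
  have q: "0 \<le> q" "q < 1"
    using p False by (auto simp: q_def)
  show ?thesis
  proof (rule that[of 1])
    fix s :: real assume s: "0 < s"
    \<comment> \<open>midpoint concavity at \<open>s\<close> and 1, from convexity of the inverse power \<open>1 / q\<close>\<close>
    have conc: "(s powr q + 1) / 2 \<le> ((1 + s) / 2) powr q"
    proof (cases "q = 0")
      case True
      then show ?thesis using s by simp
    next
      case nz: False
      have "((s powr q + 1) / 2) powr (1 / q) \<le> (1 + s) / 2"
        using convex_powr_nonneg[of "1 / q" "s powr q" 1 "1/2" "1/2"] s q nz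
        by (simp add: powr_powr add_divide_distrib add.commute)
      then have "(((s powr q + 1) / 2) powr (1 / q)) powr q \<le> ((1 + s) / 2) powr q"
        using q by (intro powr_mono2) auto
      then show ?thesis
        using nz by (simp add: powr_powr add_nonneg_pos)
    qed
    have c: "2 powr \<bar>p - 2\<bar> = 2 / 2 powr q"
      using False powr_diff[of 2 1 q] by (simp add: q_def)
    show "s powr (p - 1) + 1 \<le> 2 powr \<bar>p - 2\<bar> * (1 + s) powr (p - 1)"
      using conc s unfolding c q_def[symmetric] by (simp add: powr_divide field_simps)
    \<comment> \<open>subadditivity, since \<open>x powr (q - 1)\<close> is decreasing\<close>
    have "(1 + s) powr q = (1 + s) powr (q - 1) + s * (1 + s) powr (q - 1)"
      using s powr_add[of "1 + s" 1 "q - 1"] by (simp add: distrib_right)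
    also have "\<dots> \<le> 1 + s * s powr (q - 1)"
      using s q powr_mono2'[of "q - 1" 1 "1 + s"] by (intro add_mono mult_left_mono powr_mono2') auto
    also have "s * s powr (q - 1) = s powr q"
      using s powr_add[of s 1 "q - 1"] by simp
    also have "s powr q \<le> 2 powr \<bar>p - 2\<bar> * s powr q"
      using mult_right_mono[of 1 "2 powr \<bar>p - 2\<bar>" "s powr q"] by (simp add: ge_one_powr_ge_zero)
    finally show "(1 + s) powr (p - 1) \<le> 2 powr \<bar>p - 2\<bar> * s powr (p - 1) + 1"
      by (simp add: q_def)
  qed simp
qed

text \<open>
  To the right of 1 put \<open>x = 1 + s\<close>, to the left of 0 put \<open>x = -s\<close>: in both cases the difference of the
  two sides is nondecreasing in \<open>s \<ge> 0\<close> by \<open>powr_slopes\<close>, and nonnegative at \<open>s = 0\<close>. Between 0 and 1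
  the linear term alone dominates.
\<close>

lemma powr_shift_one:
  fixes p :: real
  assumes p: "1 \<le> p"
  obtains K where "\<And>x. \<bar>x - 1\<bar> powr p \<le> 2 powr \<bar>p - 2\<bar> * \<bar>x\<bar> powr p + K * (1 - x)"
proof -
  define c :: real where "c = 2 powr \<bar>p - 2\<bar>"
  have c: "1 \<le> c"
    by (simp add: c_def ge_one_powr_ge_zero)
  obtain \<kappa> where \<kappa>: "1 \<le> \<kappa>"
    and lower: "\<And>s. 0 < s \<Longrightarrow> s powr (p - 1) + \<kappa> \<le> c * (1 + s) powr (p - 1)"
    and upper: "\<And>s. 0 < s \<Longrightarrow> (1 + s) powr (p - 1) \<le> c * s powr (p - 1) + \<kappa>"
    using powr_slopes[OF p] unfolding c_def by metis
  have pk: "1 \<le> p * \<kappa>"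
    using p \<kappa> mult_mono[of 1 p 1 \<kappa>] by simp
  have *: "s powr p + p * \<kappa> * s \<le> c * (1 + s) powr p \<and> (1 + s) powr p \<le> c * s powr p + p * \<kappa> * (1 + s)"
    if s: "0 \<le> s" for s :: real
  proof -
    let ?A = "\<lambda>s. c * (1 + s) powr p - s powr p - p * \<kappa> * s"
    let ?B = "\<lambda>s. c * s powr p + p * \<kappa> * (1 + s) - (1 + s) powr p"
    have "?A 0 \<le> ?A s"
    proof (rule DERIV_nonneg_imp_increasing_open[OF s])
      fix x assume x: "0 < x" "x < s"
      have "(?A has_real_derivative p * (c * (1 + x) powr (p - 1) - x powr (p - 1) - \<kappa>)) (at x)"
        using x by (auto intro!: derivative_eq_intros simp: algebra_simps)
      moreover have "0 \<le> p * (c * (1 + x) powr (p - 1) - x powr (p - 1) - \<kappa>)"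
        using lower[OF x(1)] p by (intro mult_nonneg_nonneg) auto
      ultimately show "\<exists>y. (?A has_real_derivative y) (at x) \<and> 0 \<le> y"
        by blast
    qed (use p in \<open>auto intro!: continuous_intros continuous_on_powr'\<close>)
    moreover have "?B 0 \<le> ?B s"
    proof (rule DERIV_nonneg_imp_increasing_open[OF s])
      fix x assume x: "0 < x" "x < s"
      have "(?B has_real_derivative p * (c * x powr (p - 1) + \<kappa> - (1 + x) powr (p - 1))) (at x)"
        using x by (auto intro!: derivative_eq_intros simp: algebra_simps)
      moreover have "0 \<le> p * (c * x powr (p - 1) + \<kappa> - (1 + x) powr (p - 1))"
        using upper[OF x(1)] p by (intro mult_nonneg_nonneg) auto
      ultimately show "\<exists>y. (?B has_real_derivative y) (at x) \<and> 0 \<le> y"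
        by blast
    qed (use p in \<open>auto intro!: continuous_intros continuous_on_powr'\<close>)
    ultimately show ?thesis
      using pk c by simp
  qed
  show ?thesis
  proof (rule that[of "p * \<kappa>"])
    fix x :: real
    consider "1 \<le> x" | "x \<le> 0" | "0 \<le> x" "x \<le> 1"
      by linarith
    then show "\<bar>x - 1\<bar> powr p \<le> 2 powr \<bar>p - 2\<bar> * \<bar>x\<bar> powr p + p * \<kappa> * (1 - x)"
    proof cases
      case 1
      then show ?thesis
        using *[of "x - 1"] by (simp add: c_def algebra_simps)
    next
      case 2
      then show ?thesis
        using *[of "- x"] by (simp add: c_def algebra_simps)
    next
      case 3
      have "(1 - x) powr p \<le> 1 - x"
        using 3 p powr_mono'[of 1 p "1 - x"] by (cases "x = 1") auto
      also have "\<dots> \<le> p * \<kappa> * (1 - x)"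
        using 3 pk mult_right_mono[of 1 "p * \<kappa>" "1 - x"] by simp
      finally show ?thesis
        using 3 by (simp add: add_increasing)
    qed
  qed
qed

text \<open>For \<open>m \<noteq> 0\<close> this is the case \<open>m = 1\<close> scaled by \<open>m\<close>.\<close>

lemma powr_shift:
  fixes p m :: real
  assumes p: "1 \<le> p"
  obtains K where "\<And>x. \<bar>x - m\<bar> powr p \<le> 2 powr \<bar>p - 2\<bar> * \<bar>x\<bar> powr p + K * (m - x)"
proof (cases "m = 0")
  case True
  have "\<bar>x\<bar> powr p \<le> 2 powr \<bar>p - 2\<bar> * \<bar>x\<bar> powr p" for x
    using mult_right_mono[of 1 "2 powr \<bar>p - 2\<bar>" "\<bar>x\<bar> powr p"] by (simp add: ge_one_powr_ge_zero)
  then show ?thesis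
    using that[of 0] True by simp
next
  case False
  obtain K where K: "\<And>x. \<bar>x - 1\<bar> powr p \<le> 2 powr \<bar>p - 2\<bar> * \<bar>x\<bar> powr p + K * (1 - x)"
    using powr_shift_one[OF p] by blast
  show ?thesis
  proof (rule that[of "\<bar>m\<bar> powr p * K / m"])
    fix x
    have "\<bar>x - m\<bar> = \<bar>m\<bar> * \<bar>x / m - 1\<bar>" "\<bar>x\<bar> = \<bar>m\<bar> * \<bar>x / m\<bar>"
      using False by (auto simp: abs_mult[symmetric] field_simps)
    then have eq: "\<bar>x - m\<bar> powr p = \<bar>m\<bar> powr p * \<bar>x / m - 1\<bar> powr p"
        "\<bar>x\<bar> powr p = \<bar>m\<bar> powr p * \<bar>x / m\<bar> powr p"
      by (metis abs_ge_zero powr_mult)+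
    have "\<bar>m\<bar> powr p * \<bar>x / m - 1\<bar> powr p \<le>
        \<bar>m\<bar> powr p * (2 powr \<bar>p - 2\<bar> * \<bar>x / m\<bar> powr p + K * (1 - x / m))"
      by (intro mult_left_mono K) auto
    also have "\<dots> = 2 powr \<bar>p - 2\<bar> * \<bar>x\<bar> powr p + \<bar>m\<bar> powr p * K / m * (m - x)"
      unfolding eq(2) using False by (simp add: field_simps)
    finally show "\<bar>x - m\<bar> powr p \<le> 2 powr \<bar>p - 2\<bar> * \<bar>x\<bar> powr p + \<bar>m\<bar> powr p * K / m * (m - x)"
      by (simp only: eq(1))
  qed
qed

text \<open>
  Averaging \<open>powr_shift\<close>, with \<open>m\<close> the weighted mean of the \<open>a\<^sub>i\<close>, cancels the linear term. For \<open>p = 2\<close>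
  this says that a variance is at most the second moment.
\<close>

lemma sum_powr_deviation_from_mean_le:
  fixes a w :: "'i \<Rightarrow> real"
  assumes p: "1 \<le> p" and w: "\<And>i. i \<in> S \<Longrightarrow> 0 \<le> w i" "sum w S = 1"
  shows "(\<Sum>i\<in>S. w i * \<bar>(\<Sum>j\<in>S. w j * a j) - a i\<bar> powr p)
    \<le> 2 powr \<bar>p - 2\<bar> * (\<Sum>i\<in>S. w i * \<bar>a i\<bar> powr p)"
proof -
  define m where "m = (\<Sum>j\<in>S. w j * a j)"
  obtain K where K: "\<And>x. \<bar>x - m\<bar> powr p \<le> 2 powr \<bar>p - 2\<bar> * \<bar>x\<bar> powr p + K * (m - x)"
    using powr_shift[OF p] by blast
  have "(\<Sum>i\<in>S. w i * \<bar>m - a i\<bar> powr p)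
      \<le> (\<Sum>i\<in>S. w i * (2 powr \<bar>p - 2\<bar> * \<bar>a i\<bar> powr p + K * (m - a i)))"
    using w(1) K by (intro sum_mono mult_left_mono) (simp_all only: abs_minus_commute[of m])
  also have "\<dots> = 2 powr \<bar>p - 2\<bar> * (\<Sum>i\<in>S. w i * \<bar>a i\<bar> powr p) + K * (m * sum w S - m)"
  proof -
    have "(\<Sum>i\<in>S. w i * (2 powr \<bar>p - 2\<bar> * \<bar>a i\<bar> powr p + K * (m - a i)))
        = (\<Sum>i\<in>S. 2 powr \<bar>p - 2\<bar> * (w i * \<bar>a i\<bar> powr p) + (K * m * w i - K * (w i * a i)))"
      by (intro sum.cong) (simp_all add: algebra_simps)
    then show ?thesis
      by (simp add: sum.distrib sum_subtractf sum_distrib_left[symmetric] m_def[symmetric]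
          right_diff_distrib)
  qed
  finally show ?thesis
    by (simp add: w m_def)
qed

section \<open>Convex hulls in \<open>L\<^sub>p\<close>\<close>

lemma Lp_fun_sum:
  assumes p: "1 \<le> p" and "finite S" and "S \<subseteq> Lp_fun p M"
  shows "(\<lambda>x. \<Sum>f\<in>S. w f * f x) \<in> Lp_fun p M"
  using assms(2,3)
proof (induction S)
  case empty
  then show ?case by (simp add: Lp_fun_zero)
next
  case (insert f S)
  then show ?case
    using Lp_fun_add(1)[OF p Lp_fun_scale(1)[OF p, of f M "w f"]] by simp
qed

text \<open>
  The hull is defined as an intersection of convex sets. The classes of finite convex combinations of
  representatives form a convex set containing the generators, so the hull lies inside it. Working
  with representatives makes pointwise arguments available.
\<close>

lemma conv_hull_Lp_combination:
  assumes p: "1 \<le> p" and A: "A \<subseteq> Lp_fun p M" and F: "F \<in> conv_hull (Lp p M) (Lp_class p M ` A)"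
  obtains S w where "finite S" "S \<subseteq> A" "\<And>f. f \<in> S \<Longrightarrow> 0 \<le> w f" "sum w S = 1"
    and "F = Lp_class p M (\<lambda>x. \<Sum>f\<in>S. w f * f x)"
proof -
  let ?comb = "\<lambda>S w. Lp_class p M (\<lambda>x. \<Sum>f\<in>S. w f * f x)"
  define C where "C = {?comb S w | S w.
    finite S \<and> S \<subseteq> A \<and> (\<forall>f\<in>S. 0 \<le> w f) \<and> sum w S = (1::real)}"
  have "convex_in (Lp p M) C"
    unfolding convex_in_def
  proof (intro conjI ballI allI impI)
    show "C \<subseteq> carrier (Lp p M)"
      using A by (force simp: C_def carrier_Lp intro!: imageI Lp_fun_sum[OF p])
  next
    fix G H and u v :: real
    assume GH: "G \<in> C" "H \<in> C" and uv: "0 \<le> u" "0 \<le> v" "u + v = 1"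
    obtain S w where S: "G = ?comb S w" "finite S" "S \<subseteq> A" "\<forall>f\<in>S. 0 \<le> w f" "sum w S = 1"
      using GH(1) by (auto simp: C_def)
    obtain T z where T: "H = ?comb T z" "finite T" "T \<subseteq> A" "\<forall>f\<in>T. 0 \<le> z f" "sum z T = 1"
      using GH(2) by (auto simp: C_def)
    \<comment> \<open>both combinations mixed, with weights extended by 0 to \<open>S \<union> T\<close>\<close>
    define y where "y f = u * (if f \<in> S then w f else 0) + v * (if f \<in> T then z f else 0)" for f
    have sum_y: "(\<Sum>f\<in>S \<union> T. y f * h f) = u * (\<Sum>f\<in>S. w f * h f) + v * (\<Sum>f\<in>T. z f * h f)" for h
    proof -
      have "(\<Sum>f\<in>S \<union> T. (if f \<in> S then w f else 0) * h f) = (\<Sum>f\<in>S. w f * h f)"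
        "(\<Sum>f\<in>S \<union> T. (if f \<in> T then z f else 0) * h f) = (\<Sum>f\<in>T. z f * h f)"
        using S(2) T(2) by (auto intro!: sum.mono_neutral_cong_right)
      then show ?thesis
        by (simp add: y_def distrib_right sum.distrib mult.assoc sum_distrib_left[symmetric])
    qed
    have "S \<subseteq> Lp_fun p M" "T \<subseteq> Lp_fun p M"
      using S(3) T(3) A by auto
    then have "vadd (Lp p M) (vscale (Lp p M) u G) (vscale (Lp p M) v H) = ?comb (S \<union> T) y"
      unfolding S(1) T(1) sum_y
      by (simp add: vscale_Lp[OF p] vadd_Lp[OF p] Lp_fun_scale(1)[OF p] Lp_fun_sum[OF p] S(2) T(2))
    moreover have "sum y (S \<union> T) = 1"
      using sum_y[of "\<lambda>_. 1"] S(5) T(5) uv by simp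
    moreover have "\<forall>f\<in>S \<union> T. 0 \<le> y f"
      using S(4) T(4) uv by (simp add: y_def)
    ultimately show "vadd (Lp p M) (vscale (Lp p M) u G) (vscale (Lp p M) v H) \<in> C"
      using S(2,3) T(2,3) unfolding C_def by blast
  qed
  moreover have "Lp_class p M ` A \<subseteq> C"
  proof
    fix G assume "G \<in> Lp_class p M ` A"
    then obtain g where "g \<in> A" "G = ?comb {g} (\<lambda>_. 1)"
      by auto
    then show "G \<in> C"
      unfolding C_def by (intro CollectI exI[of _ "{g}"] exI[of _ "\<lambda>_. 1"]) auto
  qed
  ultimately have "F \<in> C"
    using F hull_minimal[of "Lp_class p M ` A" C "convex_in (Lp p M)"] by (auto simp: conv_hull_def)
  then show thesis
    unfolding C_def using that by blast
qed

lemma vdiff_Lp: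
  assumes p: "1 \<le> p" and f: "f \<in> Lp_fun p M" and g: "g \<in> Lp_fun p M"
  shows "vdiff (Lp p M) (Lp_class p M f) (Lp_class p M g) = Lp_class p M (\<lambda>x. f x - g x)"
    and "(\<lambda>x. f x - g x) \<in> Lp_fun p M"
  using vadd_Lp[OF p f Lp_fun_scale(1)[OF p g, of "-1"]] Lp_fun_add(1)[OF p f Lp_fun_scale(1)[OF p g, of "-1"]]
  by (simp_all add: vdiff_def vscale_Lp[OF p g])

lemma unit_ball_Lp:
  assumes p: "1 \<le> p"
  shows "closed_ball (Lp p M) (vzero (Lp p M)) 1 = Lp_class p M ` {f \<in> Lp_fun p M. Lp_seminorm p M f \<le> 1}"
proof -
  have "vnorm (Lp p M) (vdiff (Lp p M) (Lp_class p M f) (vzero (Lp p M))) = Lp_seminorm p M f"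
    if "f \<in> Lp_fun p M" for f
    using that vdiff_Lp(1)[OF p that Lp_fun_zero] by (simp add: vzero_Lp vnorm_Lp)
  then show ?thesis
    unfolding closed_ball_def carrier_Lp by (auto intro!: imageI)
qed

text \<open>
  Reduces a bound on the constant to a statement about functions: every finite convex combination of
  functions in the unit ball is within \<open>c\<close> of one of its members. Such a member is a point of the set
  whose hull is taken, so it bounds the distance to that set.
\<close>

lemma chd_const_Lp_le:
  assumes p: "1 \<le> p"
    and near: "\<And>S w. \<lbrakk>finite S; S \<subseteq> Lp_fun p M; \<And>f. f \<in> S \<Longrightarrow> Lp_seminorm p M f \<le> 1;
      \<And>f. f \<in> S \<Longrightarrow> 0 \<le> w f; sum w S = 1\<rbrakk>
      \<Longrightarrow> \<exists>f\<in>S. Lp_seminorm p M (\<lambda>x. (\<Sum>g\<in>S. w g * g x) - f x) \<le> c"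
  shows "chd_const (Lp p M) \<le> ereal c"
  unfolding chd_const_def deviation_def
proof (intro SUP_least)
  fix D F
  assume "D \<in> {D. D \<noteq> {} \<and> D \<subseteq> closed_ball (Lp p M) (vzero (Lp p M)) 1}"
    and F: "F \<in> conv_hull (Lp p M) D"
  then obtain A where A: "A \<subseteq> {f \<in> Lp_fun p M. Lp_seminorm p M f \<le> 1}" and D: "D = Lp_class p M ` A"
    by (auto simp: unit_ball_Lp[OF p] subset_image_iff)
  have "A \<subseteq> Lp_fun p M"
    using A by auto
  from conv_hull_Lp_combination[OF p this F[unfolded D]]
  obtain S w where S: "finite S" "S \<subseteq> A" "\<And>f. f \<in> S \<Longrightarrow> 0 \<le> w f" "sum w S = 1"
    and F_eq: "F = Lp_class p M (\<lambda>x. \<Sum>f\<in>S. w f * f x)"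
    by blast
  have SL: "S \<subseteq> Lp_fun p M"
    using S(2) A by auto
  obtain f where f: "f \<in> S" "Lp_seminorm p M (\<lambda>x. (\<Sum>g\<in>S. w g * g x) - f x) \<le> c"
    using near[OF S(1) SL _ S(3,4)] S(2) A by blast
  have sum: "(\<lambda>x. \<Sum>g\<in>S. w g * g x) \<in> Lp_fun p M"
    using Lp_fun_sum[OF p S(1) SL] .
  have fL: "f \<in> Lp_fun p M"
    using f SL by auto
  have "dist_to_set (Lp p M) F D \<le> ereal (vnorm (Lp p M) (vdiff (Lp p M) F (Lp_class p M f)))"
    unfolding dist_to_set_def using f S(2) by (intro INF_lower) (auto simp: D)
  also have "\<dots> \<le> ereal c"
    using f(2) by (simp add: F_eq vdiff_Lp[OF p sum fL] vnorm_Lp)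
  finally show "dist_to_set (Lp p M) F D \<le> ereal c" .
qed

section \<open>The bounds for finite and infinite exponents\<close>

text \<open>The scalar inequality at each point, integrated over the measure space.\<close>

lemma sum_integral_powr_deviation_le:
  assumes r: "1 \<le> r" and S: "finite S" "S \<subseteq> Lp_fun (ereal r) M"
    and w: "\<And>f. f \<in> S \<Longrightarrow> 0 \<le> w f" "sum w S = 1"
  shows "(\<Sum>f\<in>S. w f * (\<integral>x. \<bar>(\<Sum>g\<in>S. w g * g x) - f x\<bar> powr r \<partial>M))
    \<le> 2 powr \<bar>r - 2\<bar> * (\<Sum>f\<in>S. w f * (\<integral>x. \<bar>f x\<bar> powr r \<partial>M))"
proof -
  have p: "1 \<le> ereal r"
    using r by simp
  have "(\<lambda>x. (\<Sum>g\<in>S. w g * g x) + - 1 * f x) \<in> Lp_fun (ereal r) M" if "f \<in> S" for f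
    using that S by (intro Lp_fun_add(1)[OF p] Lp_fun_sum[OF p] Lp_fun_scale(1)[OF p]) auto
  then have I1: "integrable M (\<lambda>x. w f * \<bar>(\<Sum>g\<in>S. w g * g x) - f x\<bar> powr r)" if "f \<in> S" for f
    using that by (auto simp: Lp_fun_def)
  have I2: "integrable M (\<lambda>x. w f * \<bar>f x\<bar> powr r)" if "f \<in> S" for f
    using that S by (auto simp: Lp_fun_def)
  have "(\<Sum>f\<in>S. w f * (\<integral>x. \<bar>(\<Sum>g\<in>S. w g * g x) - f x\<bar> powr r \<partial>M))
      = (\<integral>x. (\<Sum>f\<in>S. w f * \<bar>(\<Sum>g\<in>S. w g * g x) - f x\<bar> powr r) \<partial>M)"
    using I1 by (simp add: Bochner_Integration.integral_sum)
  also have "\<dots> \<le> (\<integral>x. 2 powr \<bar>r - 2\<bar> * (\<Sum>f\<in>S. w f * \<bar>f x\<bar> powr r) \<partial>M)"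
    using I1 I2 sum_powr_deviation_from_mean_le[OF r w]
    by (intro integral_mono Bochner_Integration.integrable_sum integrable_mult_right) auto
  also have "\<dots> = 2 powr \<bar>r - 2\<bar> * (\<Sum>f\<in>S. w f * (\<integral>x. \<bar>f x\<bar> powr r \<partial>M))"
    using I2 by (simp add: Bochner_Integration.integral_sum)
  finally show ?thesis .
qed

text \<open>
  If every member of a convex combination were farther from it than the bound, then the weighted
  average of the \<open>r\<close>-th powers of the distances would exceed \<open>2 powr \<bar>r - 2\<bar>\<close>, which
  \<open>sum_integral_powr_deviation_le\<close> excludes.
\<close>

lemma chd_const_Lp_finite_exponent:
  assumes r: "1 \<le> r"
  shows "chd_const (Lp (ereal r) M) \<le> ereal (2 powr (\<bar>r - 2\<bar> / r))"
proof (rule chd_const_Lp_le)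
  fix S and w :: "('a \<Rightarrow> real) \<Rightarrow> real"
  assume S: "finite S" "S \<subseteq> Lp_fun (ereal r) M" "\<And>f. f \<in> S \<Longrightarrow> Lp_seminorm (ereal r) M f \<le> 1"
    and w: "\<And>f. f \<in> S \<Longrightarrow> 0 \<le> w f" "sum w S = 1"
  define I where "I f = (\<integral>x. \<bar>(\<Sum>g\<in>S. w g * g x) - f x\<bar> powr r \<partial>M)" for f
  have unit: "(\<integral>x. \<bar>f x\<bar> powr r \<partial>M) \<le> 1" if "f \<in> S" for f
  proof -
    have "(\<integral>x. \<bar>f x\<bar> powr r \<partial>M) = Lp_seminorm (ereal r) M f powr r"
      using r by (simp add: Lp_seminorm_def powr_powr)
    also have "\<dots> \<le> 1 powr r"
      using r S(3)[OF that] by (intro powr_mono2 Lp_seminorm_nonneg) auto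
    finally show ?thesis
      by simp
  qed
  have "\<exists>f\<in>S. I f \<le> 2 powr \<bar>r - 2\<bar>"
  proof (rule ccontr)
    assume neg: "\<not> ?thesis"
    obtain f where f: "f \<in> S" "0 < w f"
      using w(2) sum_nonpos[of S w] by (metis not_le zero_less_one)
    have "2 powr \<bar>r - 2\<bar> = (\<Sum>f\<in>S. w f * 2 powr \<bar>r - 2\<bar>)"
      by (simp add: sum_distrib_right[symmetric] w)
    also have "\<dots> < (\<Sum>f\<in>S. w f * I f)"
    proof (rule sum_strict_mono_ex1[OF S(1)])
      show "\<forall>g\<in>S. w g * 2 powr \<bar>r - 2\<bar> \<le> w g * I g"
        using neg w(1) by (intro ballI mult_left_mono) (meson linear, blast)
      show "\<exists>g\<in>S. w g * 2 powr \<bar>r - 2\<bar> < w g * I g"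
        using neg f by (intro bexI[of _ f] mult_strict_left_mono) (meson not_le, blast+)
    qed
    also have "\<dots> \<le> 2 powr \<bar>r - 2\<bar> * (\<Sum>f\<in>S. w f * (\<integral>x. \<bar>f x\<bar> powr r \<partial>M))"
      unfolding I_def using sum_integral_powr_deviation_le[OF r S(1,2) w] .
    also have "\<dots> \<le> 2 powr \<bar>r - 2\<bar> * (\<Sum>f\<in>S. w f * 1)"
      using unit w by (intro mult_left_mono sum_mono) auto
    finally show False
      using w by simp
  qed
  then obtain f where f: "f \<in> S" "I f \<le> 2 powr \<bar>r - 2\<bar>"
    by blast
  have "0 \<le> I f"
    by (simp add: I_def)
  with f(2) have "I f powr (1 / r) \<le> (2 powr \<bar>r - 2\<bar>) powr (1 / r)"
    using r by (intro powr_mono2) auto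
  with f(1) show "\<exists>f\<in>S. Lp_seminorm (ereal r) M (\<lambda>x. (\<Sum>g\<in>S. w g * g x) - f x) \<le> 2 powr (\<bar>r - 2\<bar> / r)"
    by (auto simp: Lp_seminorm_def I_def powr_powr)
qed (use r in simp)

text \<open>
  Almost everywhere, all members of a finite convex combination have absolute value at most 1, hence so
  has the combination.
\<close>

lemma chd_const_L_infinity:
  "chd_const (Lp \<infinity> M) \<le> ereal 2"
proof (rule chd_const_Lp_le)
  fix S and w :: "('a \<Rightarrow> real) \<Rightarrow> real"
  assume S: "finite S" "S \<subseteq> Lp_fun \<infinity> M" "\<And>f. f \<in> S \<Longrightarrow> Lp_seminorm \<infinity> M f \<le> 1"
    and w: "\<And>f. f \<in> S \<Longrightarrow> 0 \<le> w f" "sum w S = 1"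
  obtain f where f: "f \<in> S"
    using w(2) by (cases "S = {}") auto
  have "AE x in M. \<bar>g x\<bar> \<le> 1" if "g \<in> S" for g
    using Lp_fun_infinity_bound[of g M] S(2,3) that by (force elim: eventually_mono)
  then have "AE x in M. \<forall>g\<in>S. \<bar>g x\<bar> \<le> 1"
    using S(1) by (simp add: AE_finite_all)
  then have "AE x in M. \<bar>(\<Sum>g\<in>S. w g * g x) - f x\<bar> \<le> 2"
  proof eventually_elim
    case (elim x)
    have "\<bar>\<Sum>g\<in>S. w g * g x\<bar> \<le> (\<Sum>g\<in>S. w g * 1)"
      using elim w by (intro order_trans[OF sum_abs] sum_mono) (auto simp: abs_mult intro!: mult_left_le)
    then have "\<bar>\<Sum>g\<in>S. w g * g x\<bar> \<le> 1"
      using w(2) by simp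
    moreover have "\<bar>f x\<bar> \<le> 1"
      using elim f by blast
    ultimately show ?case
      by linarith
  qed
  moreover have "(\<lambda>x. (\<Sum>g\<in>S. w g * g x) - f x) \<in> borel_measurable M"
    using S(1,2) f by (intro Lp_fun_measurable[of _ \<infinity>] vdiff_Lp(2) Lp_fun_sum) auto
  ultimately show "\<exists>f\<in>S. Lp_seminorm \<infinity> M (\<lambda>x. (\<Sum>g\<in>S. w g * g x) - f x) \<le> 2"
    using f by (intro bexI[of _ f] Lp_infinity_boundI(2)) auto
qed simp

section \<open>The convex hull deviation constant of \<open>L\<^sub>p\<close>\<close>

theorem theorem2:
  fixes M :: "'a measure" and p p' :: ereal
  assumes "1 \<le> p" and "1 \<le> p'" and "1 / p + 1 / p' = 1"
  shows "chd_const (Lp p M) \<le> ereal (2 powr \<bar>real_of_ereal (1 / p) - real_of_ereal (1 / p')\<bar>)"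
  using assms(1)
proof (cases p rule: exponent_cases)
  case 1
  then show ?thesis
    using assms(3) chd_const_L_infinity[of M] by simp
next
  case (2 r)
  have "1 / p = ereal (1 / r)"
    using 2 by (simp add: one_ereal_def)
  moreover have "1 / p' = ereal (1 - 1 / r)"
    using assms(3) calculation by (cases "1 / p'") (auto simp: one_ereal_def)
  moreover have "\<bar>1 / r - (1 - 1 / r)\<bar> = \<bar>r - 2\<bar> / r"
    using 2 by (simp add: abs_if field_simps)
  ultimately show ?thesis
    using chd_const_Lp_finite_exponent[of r M] 2 by simp
qed

end
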